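(* Let $h\ge 2$ and let $T_h$ be the complete binary tree of height $h$. Every layout of $T_h$ of \textsc{MinWLA} type attains the minimum value of the weighted mean edge length $\bar\ell_1$ over all Recursive Layouts of $T_h$ with cut height $g=1$.
   Context: The complete binary tree $T_h$ of height $h$ has levels $0,\dots,h-1$ (the root is on level $0$, level $d$ has $2^d$ nodes), hence $2^h-1$ nodes. A layout is a bijection $\pi$ from the nodes to $\{1,\dots,2^h-1\}$. For an edge $e=uv$ its length is $\ell_e=|\pi(u)-\pi(v)|$. If $e$ joins a node on level $d-1$ to a node on level $d$, its weight is $w_e=2^{-d}$. Let $W=\sum_e w_e$. The weighted mean edge length is $\bar\ell_1=\frac1W\sum_e w_e\ell_e$. For a node $v$, let $T_v$ denote the subtree consisting of $v$ and all its descendants. A Recursive Layout with cut height $1$ is a layout $\pi$ satisfying the following conditions. First, for every node $v$ the set $\pi(T_v)$ is a contiguous interval of integers. Second, every node $v$ with children, i.e. every $v$ for which $T_v$ has height at least $2$, has one of two types: - in-order type: $\pi(v)$ lies strictly between the intervals occupied by its two child subtrees; - pre-order type: $\pi(v)$ is an endpoint of the interval $\pi(T_v)$, so both child subtrees lie on the same side of $\pi(v)$. This type covers both pre-order and post-order placement. Either child subtree may be placed on either side. The layout is further constrained as follows: (i) if $v$ is not the root and has pre-order type, then $\pi(v)$ is the endpoint of $\pi(T_v)$ nearer to $\pi(\mathrm{parent}(v))$; (ii) if $v$ has pre-order type, both of its children have children, and the child subtree whose interval is adjacent to $\pi(v)$ has a root of in-order type, then the root of the other child subtree also has in-order type. A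 \textsc{MinWLA}-type layout is a Recursive Layout with cut height $1$ in which the root has in-order type and every other node with children has pre-order type. *)

theory Defs
  imports Complex_Main
begin

text \<open>
  A node of the complete binary tree of height \<open>h\<close> is the list of left/right
  turns leading to it from the root, so \<open>[]\<close> is the root, \<open>length v\<close> is the
  level of \<open>v\<close>, the children of \<open>v\<close> are \<open>v @ [False]\<close> and \<open>v @ [True]\<close>, and the
  parent of \<open>v \<noteq> []\<close> is \<open>butlast v\<close>. Layouts are total functions of which only the
  values on \<open>nodes h\<close> matter; positions are integers so that subtraction does
  not truncate.
\<close>

type_synonym node = "bool list"

definition nodes :: "nat \<Rightarrow> node set" where
  "nodes h = {v. length v < h}"

definition edges :: "nat \<Rightarrow> (node \<times> node) set" where
  "edges h = {(v, v @ [b]) | v b. v @ [b] \<in> nodes h}"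

definition subtree :: "nat \<Rightarrow> node \<Rightarrow> node set" where
  "subtree h v = {v @ w | w. v @ w \<in> nodes h}"

definition has_children :: "nat \<Rightarrow> node \<Rightarrow> bool" where
  "has_children h v \<longleftrightarrow> (\<forall>b. v @ [b] \<in> nodes h)"

definition layout :: "nat \<Rightarrow> (node \<Rightarrow> int) \<Rightarrow> bool" where
  "layout h \<pi> \<longleftrightarrow> bij_betw \<pi> (nodes h) {1..2 ^ h - 1}"

definition edge_length :: "(node \<Rightarrow> int) \<Rightarrow> node \<times> node \<Rightarrow> real" where
  "edge_length \<pi> e = real_of_int \<bar>\<pi> (fst e) - \<pi> (snd e)\<bar>"

definition edge_weight :: "node \<times> node \<Rightarrow> real" where
  "edge_weight e = 1 / 2 ^ length (snd e)"

definition weighted_mean_edge_length :: "nat \<Rightarrow> (node \<Rightarrow> int) \<Rightarrow> real" where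
  "weighted_mean_edge_length h \<pi> =
     (\<Sum>e\<in>edges h. edge_weight e * edge_length \<pi> e) / (\<Sum>e\<in>edges h. edge_weight e)"

definition in_order_type :: "nat \<Rightarrow> (node \<Rightarrow> int) \<Rightarrow> node \<Rightarrow> bool" where
  "in_order_type h \<pi> v \<longleftrightarrow> has_children h v \<and>
     (\<exists>b. (\<forall>x\<in>\<pi> ` subtree h (v @ [b]). x < \<pi> v) \<and>
          (\<forall>y\<in>\<pi> ` subtree h (v @ [\<not> b]). \<pi> v < y))"

definition pre_order_type :: "nat \<Rightarrow> (node \<Rightarrow> int) \<Rightarrow> node \<Rightarrow> bool" where
  "pre_order_type h \<pi> v \<longleftrightarrow> has_children h v \<and>
     (\<pi> v = Min (\<pi> ` subtree h v) \<or> \<pi> v = Max (\<pi> ` subtree h v))"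

definition at_endpoint_nearer_to :: "nat \<Rightarrow> (node \<Rightarrow> int) \<Rightarrow> node \<Rightarrow> int \<Rightarrow> bool" where
  "at_endpoint_nearer_to h \<pi> v p \<longleftrightarrow>
     (let l = Min (\<pi> ` subtree h v); r = Max (\<pi> ` subtree h v)
      in \<pi> v = l \<and> \<bar>l - p\<bar> < \<bar>r - p\<bar> \<or> \<pi> v = r \<and> \<bar>r - p\<bar> < \<bar>l - p\<bar>)"

definition adjacent_subtree :: "nat \<Rightarrow> (node \<Rightarrow> int) \<Rightarrow> node \<Rightarrow> int \<Rightarrow> bool" where
  "adjacent_subtree h \<pi> c p \<longleftrightarrow>
     Min (\<pi> ` subtree h c) = p + 1 \<or> Max (\<pi> ` subtree h c) = p - 1"

text \<open>
  The cut height is fixed to \<open>1\<close>. Every subtree occupies an interval, so in the last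
  clause exactly one child subtree of a pre-order node is adjacent to it.
\<close>

definition recursive_layout :: "nat \<Rightarrow> (node \<Rightarrow> int) \<Rightarrow> bool" where
  "recursive_layout h \<pi> \<longleftrightarrow>
     layout h \<pi> \<and>
     (\<forall>v\<in>nodes h. \<exists>l r. \<pi> ` subtree h v = {l..r}) \<and>
     (\<forall>v\<in>nodes h. has_children h v \<longrightarrow> in_order_type h \<pi> v \<or> pre_order_type h \<pi> v) \<and>
     (\<forall>v\<in>nodes h. v \<noteq> [] \<and> pre_order_type h \<pi> v \<longrightarrow>
        at_endpoint_nearer_to h \<pi> v (\<pi> (butlast v))) \<and>
     (\<forall>v\<in>nodes h. \<forall>b.
        pre_order_type h \<pi> v \<and> (\<forall>b'. has_children h (v @ [b'])) \<and>
        adjacent_subtree h \<pi> (v @ [b]) (\<pi> v) \<and> in_order_type h \<pi> (v @ [b]) \<longrightarrow>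
        in_order_type h \<pi> (v @ [\<not> b]))"

definition minwla_layout :: "nat \<Rightarrow> (node \<Rightarrow> int) \<Rightarrow> bool" where
  "minwla_layout h \<pi> \<longleftrightarrow>
     recursive_layout h \<pi> \<and> in_order_type h \<pi> [] \<and>
     (\<forall>v\<in>nodes h. v \<noteq> [] \<and> has_children h v \<longrightarrow> pre_order_type h \<pi> v)"

end

theory Submission
  imports Defs
begin

text \<open>
  Split the length of an edge from \<open>v\<close> to its child \<open>c\<close> into the distance from \<open>v\<close> to the
  interval of \<open>c\<close> and the distance from the near end of that interval to \<open>c\<close>. If \<open>T\<^sub>v\<close> has
  height \<open>n\<close>, the first parts for the two children add up to \<open>2\<close> or \<open>2 ^ (n - 1) + 1\<close> when \<open>v\<close>
  has in-order or pre-order type, and the second part is \<open>2 ^ (m - 1) - 1\<close> or \<open>0\<close> when \<open>T\<^sub>c\<close> has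
  height \<open>m\<close>. Since the weight of a child edge is half that of the parent edge, regrouping by
  nodes turns the total into a sum over nodes in which each summand depends only on the type
  of its own node: a non-root node contributes \<open>2 ^ (n - 1)\<close> (in-order) or
  \<open>(2 ^ (n - 1) + 1) / 2\<close> (pre-order) times its weight, the root \<open>1\<close> (in-order) or
  \<open>(2 ^ (n - 1) + 1) / 2\<close> (pre-order). A MinWLA-type layout minimises every summand.
\<close>

text \<open>The distance from \<open>v\<close> to the end of its interval that faces its parent. The
  default \<open>0\<close> serves pre-order nodes and also leaves, which never satisfy
  \<open>in_order_type\<close>.\<close>

definition entry_offset :: "nat \<Rightarrow> (node \<Rightarrow> int) \<Rightarrow> node \<Rightarrow> int" where
  "entry_offset h \<sigma> v = (if in_order_type h \<sigma> v then 2 ^ (h - length v - 1) - 1 else 0)"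

text \<open>The sum, over both children, of the distance from \<open>v\<close> to the near end of
  the child's interval: \<open>1 + 1\<close>, or \<open>1 + (s + 1)\<close> when a block of
  \<open>s = 2 ^ (h - length v - 1) - 1\<close> positions separates \<open>v\<close> from the far
  child. Intended for nodes with children.\<close>

definition child_gaps :: "nat \<Rightarrow> (node \<Rightarrow> int) \<Rightarrow> node \<Rightarrow> int" where
  "child_gaps h \<sigma> v = (if in_order_type h \<sigma> v then 2 else 2 ^ (h - length v - 1) + 1)"

section \<open>Size and containment of subtrees\<close>

lemma has_children_iff: "has_children h v \<longleftrightarrow> Suc (length v) < h"
  by (simp add: has_children_def nodes_def)

lemma finite_nodes: "finite (nodes h)"
proof -
  have "nodes h \<subseteq> {xs. set xs \<subseteq> UNIV \<and> length xs \<le> h}"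
    by (auto simp: nodes_def)
  then show ?thesis
    using finite_lists_length_le[of "UNIV :: bool set" h] finite_subset by auto
qed

lemma card_nodes: "card (nodes m) = 2 ^ m - 1"
proof (induction m)
  case 0
  then show ?case by (simp add: nodes_def)
next
  case (Suc m)
  have split: "nodes (Suc m) = nodes m \<union> {xs. set xs \<subseteq> (UNIV :: bool set) \<and> length xs = m}"
    by (auto simp: nodes_def)
  have "card {xs. set xs \<subseteq> (UNIV :: bool set) \<and> length xs = m} = 2 ^ m"
    by (subst card_lists_length_eq) auto
  moreover have "finite {xs. set xs \<subseteq> (UNIV :: bool set) \<and> length xs = m}"
    by (rule finite_lists_length_eq) simp
  ultimately have "card (nodes (Suc m)) = card (nodes m) + 2 ^ m"
    unfolding split using finite_nodes[of m]
    by (subst card_Un_disjoint) (auto simp: nodes_def)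
  then show ?case using Suc by simp
qed

lemma subtree_eq_image: "subtree h v = (@) v ` nodes (h - length v)"
  by (auto simp: subtree_def nodes_def image_def)

lemma card_subtree: "card (subtree h v) = 2 ^ (h - length v) - 1"
  unfolding subtree_eq_image by (subst card_image) (auto simp: inj_on_def card_nodes)

lemma finite_subtree: "finite (subtree h v)"
  by (simp add: subtree_eq_image finite_nodes)

lemma subtree_subset_nodes: "subtree h v \<subseteq> nodes h"
  by (auto simp: subtree_def)

lemma root_in_subtree: "v \<in> nodes h \<Longrightarrow> v \<in> subtree h v"
  by (auto simp: subtree_def)

lemma subtree_child_subset: "subtree h (v @ [b]) \<subseteq> subtree h v"
  by (auto simp: subtree_def)

lemma not_in_subtree_child: "v \<notin> subtree h (v @ [b])"
  by (auto simp: subtree_def)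

lemma subtree_children_disjoint: "subtree h (v @ [False]) \<inter> subtree h (v @ [True]) = {}"
  by (auto simp: subtree_def)

section \<open>Positions forced by a recursive layout\<close>

lemma recursive_layout_inj_on: "recursive_layout h \<sigma> \<Longrightarrow> inj_on \<sigma> (nodes h)"
  by (simp add: recursive_layout_def layout_def bij_betw_def)

lemma subtree_interval:
  assumes "recursive_layout h \<sigma>" and "v \<in> nodes h"
  obtains l where "\<sigma> ` subtree h v = {l..l + 2 ^ (h - length v) - 2}"
proof -
  obtain l r where lr: "\<sigma> ` subtree h v = {l..r}"
    using assms unfolding recursive_layout_def by blast
  have "card (\<sigma> ` subtree h v) = 2 ^ (h - length v) - 1"
    using recursive_layout_inj_on[OF assms(1)] subtree_subset_nodes card_subtree
    by (metis card_image inj_on_subset)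
  then have *: "nat (r - l + 1) = 2 ^ (h - length v) - 1"
    unfolding lr by simp
  \<comment> \<open>The subtree is nonempty, which rules out the case where \<open>nat\<close>
    truncates \<open>r - l + 1\<close> to \<open>0\<close>.\<close>
  have "(2::nat) ^ 1 \<le> 2 ^ (h - length v)"
    using assms(2) by (intro power_increasing) (auto simp: nodes_def)
  then have "0 < nat (r - l + 1)"
    using * by simp
  then have "r - l + 1 = int (2 ^ (h - length v) - 1)"
    using * by linarith
  also have "\<dots> = 2 ^ (h - length v) - 1"
    by (simp add: of_nat_diff)
  finally have "r = l + 2 ^ (h - length v) - 2"
    by simp
  then show thesis using that lr by blast
qed

text \<open>Turns the set-theoretic constraints on a node and its two child blocks, each of
  \<open>s\<close> positions, into linear inequalities, so that later placement questions become
  linear arithmetic.\<close>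

lemma node_and_child_intervals:
  fixes h :: nat and v :: node
  defines "s \<equiv> 2 ^ (h - length v - 1) - 1"
  assumes rec: "recursive_layout h \<sigma>" and hv: "Suc (length v) < h"
  obtains l a where "\<sigma> ` subtree h v = {l..l + 2 * s}"
    and "\<And>b. \<sigma> ` subtree h (v @ [b]) = {a b..a b + s - 1}"
    and "s \<ge> 1" and "l \<le> \<sigma> v" and "\<sigma> v \<le> l + 2 * s"
    and "\<And>b. l \<le> a b" and "\<And>b. a b + s - 1 \<le> l + 2 * s"
    and "\<And>b. \<sigma> v < a b \<or> a b + s - 1 < \<sigma> v"
    and "a False + s \<le> a True \<or> a True + s \<le> a False"
proof -
  have v: "v \<in> nodes h" and c: "\<And>b. v @ [b] \<in> nodes h"
    using hv by (auto simp: nodes_def)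
  obtain k where k: "h - length v = Suc k" "k \<ge> 1"
    using hv by (cases "h - length v") auto
  have s: "s = 2 ^ k - 1" "s \<ge> 1"
    using k power_increasing[of 1 k "2::int"] by (auto simp: s_def)
  obtain l where l: "\<sigma> ` subtree h v = {l..l + 2 * s}"
    using subtree_interval[OF rec v] k s by (auto simp: algebra_simps)
  have "\<exists>x. \<sigma> ` subtree h (v @ [b]) = {x..x + s - 1}" for b
  proof -
    have k': "h - length (v @ [b]) = k" using k by simp
    obtain x where "\<sigma> ` subtree h (v @ [b]) = {x..x + 2 ^ k - 2}"
      using subtree_interval[OF rec c[of b]] unfolding k' by blast
    moreover have "x + 2 ^ k - 2 = x + s - 1"
      using s by simp
    ultimately show ?thesis by metis
  qed
  then obtain a where a: "\<And>b. \<sigma> ` subtree h (v @ [b]) = {a b..a b + s - 1}"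
    by metis
  have inj: "inj_on \<sigma> (nodes h)"
    using rec by (rule recursive_layout_inj_on)
  have "\<sigma> v \<in> {l..l + 2 * s}"
    using root_in_subtree[OF v] l by blast
  then have "l \<le> \<sigma> v" "\<sigma> v \<le> l + 2 * s"
    by auto
  moreover have "l \<le> a b \<and> a b + s - 1 \<le> l + 2 * s" for b
  proof -
    have "{a b..a b + s - 1} \<subseteq> {l..l + 2 * s}"
      using subtree_child_subset[of h v b] a[of b] l by blast
    then show ?thesis using s(2) by simp
  qed
  moreover have "\<sigma> v < a b \<or> a b + s - 1 < \<sigma> v" for b
  proof -
    have "\<sigma> v \<notin> \<sigma> ` subtree h (v @ [b])"
      using inj_on_image_mem_iff[OF inj v subtree_subset_nodes] not_in_subtree_child by blast
    then show ?thesis unfolding a by auto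
  qed
  moreover have "a False + s \<le> a True \<or> a True + s \<le> a False"
  proof -
    have "{a False..a False + s - 1} \<inter> {a True..a True + s - 1} = {}"
      using inj_on_image_Int[OF inj subtree_subset_nodes subtree_subset_nodes,
          of "v @ [False]" "v @ [True]"]
      unfolding a subtree_children_disjoint by simp
    \<comment> \<open>Two disjoint nonempty intervals: neither left end lies in the other interval,
      so one block ends before the other starts.\<close>
    then have "a False \<notin> {a True..a True + s - 1}" "a True \<notin> {a False..a False + s - 1}"
      using s(2) by (auto simp: disjoint_iff)
    then show ?thesis by auto
  qed
  ultimately show thesis
    using l a s(2) by (intro that[of l a]) blast+
qed

text \<open>One block of \<open>s\<close> positions fits below \<open>v\<close> and another above it
  inside an interval of \<open>2 * s + 1\<close> positions, so \<open>v\<close> is the midpoint, at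
  distance \<open>s\<close> from both ends.\<close>

lemma in_order_position:
  assumes rec: "recursive_layout h \<sigma>" and io: "in_order_type h \<sigma> v"
    and img: "\<sigma> ` subtree h v = {l..r}"
  shows "\<sigma> v = l + (2 ^ (h - length v - 1) - 1)" and "\<sigma> v = r - (2 ^ (h - length v - 1) - 1)"
proof -
  define s :: int where "s = 2 ^ (h - length v - 1) - 1"
  have hv: "Suc (length v) < h"
    using io by (simp add: in_order_type_def has_children_iff)
  obtain l' a where 1: "\<sigma> ` subtree h v = {l'..l' + 2 * s}"
    and 2: "\<And>b. \<sigma> ` subtree h (v @ [b]) = {a b..a b + s - 1}"
    and 3: "s \<ge> 1" "\<And>b. l' \<le> a b" "\<And>b. a b + s - 1 \<le> l' + 2 * s"
    unfolding s_def by (rule node_and_child_intervals[OF rec hv]) blast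
  have eq: "l = l'" "r = l' + 2 * s"
    using 1 img 3(1) by auto
  obtain b where b: "\<forall>x\<in>{a b..a b + s - 1}. x < \<sigma> v" "\<forall>y\<in>{a (\<not> b)..a (\<not> b) + s - 1}. \<sigma> v < y"
    using io 2 unfolding in_order_type_def by auto
  have "a b + s - 1 < \<sigma> v" "\<sigma> v < a (\<not> b)"
    using b 3(1) by auto
  then have "\<sigma> v = l' + s"
    using 3(2)[of b] 3(3)[of "\<not> b"] by linarith
  then show "\<sigma> v = l + (2 ^ (h - length v - 1) - 1)" "\<sigma> v = r - (2 ^ (h - length v - 1) - 1)"
    using eq by (auto simp: s_def)
qed

text \<open>The two children lie on opposite sides of \<open>v\<close>, so \<open>v\<close> is
  neither extreme of its interval.\<close>

lemma in_order_not_pre_order: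
  assumes "in_order_type h \<sigma> v"
  shows "\<not> pre_order_type h \<sigma> v"
proof -
  obtain b where b: "\<forall>x\<in>\<sigma> ` subtree h (v @ [b]). x < \<sigma> v"
    "\<forall>y\<in>\<sigma> ` subtree h (v @ [\<not> b]). \<sigma> v < y" and c: "\<And>b. v @ [b] \<in> nodes h"
    using assms by (auto simp: in_order_type_def has_children_def)
  have mem: "\<sigma> (v @ [b']) \<in> \<sigma> ` subtree h v" for b'
    using root_in_subtree[OF c[of b']] subtree_child_subset[of h v b'] by blast
  have "\<sigma> (v @ [b]) < \<sigma> v" "\<sigma> v < \<sigma> (v @ [\<not> b])"
    using b root_in_subtree[OF c] by auto
  moreover have "Min (\<sigma> ` subtree h v) \<le> \<sigma> (v @ [b])" "\<sigma> (v @ [\<not> b]) \<le> Max (\<sigma> ` subtree h v)"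
    using mem finite_subtree[of h v] by auto
  ultimately show ?thesis
    by (auto simp: pre_order_type_def)
qed

text \<open>The offset is measured from the end facing the parent. An in-order child is the
  midpoint, constraint (i) puts a pre-order child at the facing end, and a leaf fills its whole
  interval.\<close>

lemma child_position:
  assumes rec: "recursive_layout h \<sigma>" and c: "v @ [b] \<in> nodes h"
    and img: "\<sigma> ` subtree h (v @ [b]) = {l..r}"
  shows "\<sigma> v < l \<Longrightarrow> \<sigma> (v @ [b]) = l + entry_offset h \<sigma> (v @ [b])"
    and "r < \<sigma> v \<Longrightarrow> \<sigma> (v @ [b]) = r - entry_offset h \<sigma> (v @ [b])"
proof -
  let ?c = "v @ [b]"
  have mem: "\<sigma> ?c \<in> {l..r}"
    using root_in_subtree[OF c] img by blast
  have goal: "(\<sigma> v < l \<longrightarrow> \<sigma> ?c = l + entry_offset h \<sigma> ?c) \<and>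
    (r < \<sigma> v \<longrightarrow> \<sigma> ?c = r - entry_offset h \<sigma> ?c)"
  proof (cases "in_order_type h \<sigma> ?c")
    case True
    then show ?thesis
      using in_order_position[OF rec True img] by (simp add: entry_offset_def)
  next
    case False
    then have off: "entry_offset h \<sigma> ?c = 0"
      by (simp add: entry_offset_def)
    show ?thesis
    proof (cases "has_children h ?c")
      case True
      then have "pre_order_type h \<sigma> ?c"
        using False rec c by (auto simp: recursive_layout_def)
      then have "at_endpoint_nearer_to h \<sigma> ?c (\<sigma> (butlast ?c))"
        using rec c unfolding recursive_layout_def by blast
      moreover have "Min {l..r} = l" "Max {l..r} = r"
        using mem by (auto intro!: Min_eqI Max_eqI)
      ultimately show ?thesis
        using mem unfolding at_endpoint_nearer_to_def img off by (auto simp: Let_def)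
    next
      case False
      then have "h - length ?c = 1"
        using c by (auto simp: has_children_iff nodes_def)
      \<comment> \<open>Height \<open>1\<close> gives an interval of the form
        \<open>{l'..l' + 2 ^ 1 - 2}\<close>, a single point.\<close>
      then obtain l' where "{l..r} = {l'..l'}"
        using subtree_interval[OF rec c] img by auto
      then show ?thesis
        using mem off by auto
    qed
  qed
  show "\<sigma> v < l \<Longrightarrow> \<sigma> ?c = l + entry_offset h \<sigma> ?c"
    and "r < \<sigma> v \<Longrightarrow> \<sigma> ?c = r - entry_offset h \<sigma> ?c"
    using goal by auto
qed

lemma entry_offset_nonneg: "0 \<le> entry_offset h \<sigma> v"
  by (simp add: entry_offset_def)

lemma child_edge_lengths:
  assumes rec: "recursive_layout h \<sigma>" and hv: "Suc (length v) < h"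
  shows "\<bar>\<sigma> v - \<sigma> (v @ [False])\<bar> + \<bar>\<sigma> v - \<sigma> (v @ [True])\<bar> =
    child_gaps h \<sigma> v + entry_offset h \<sigma> (v @ [False]) + entry_offset h \<sigma> (v @ [True])"
proof -
  define s :: int where "s = 2 ^ (h - length v - 1) - 1"
  obtain l a where 1: "\<sigma> ` subtree h v = {l..l + 2 * s}"
    and 2: "\<And>b. \<sigma> ` subtree h (v @ [b]) = {a b..a b + s - 1}"
    and 3: "s \<ge> 1" "\<And>b. l \<le> a b" "\<And>b. a b + s - 1 \<le> l + 2 * s"
    and 4: "\<And>b. \<sigma> v < a b \<or> a b + s - 1 < \<sigma> v"
      "a False + s \<le> a True \<or> a True + s \<le> a False" "l \<le> \<sigma> v" "\<sigma> v \<le> l + 2 * s"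
    unfolding s_def by (rule node_and_child_intervals[OF rec hv]) blast
  have c: "v @ [b] \<in> nodes h" for b
    using hv by (simp add: nodes_def)
  \<comment> \<open>The conditional is the gap to the near end of the child's block; since the
    offset is nonnegative, the two parts add without cancellation.\<close>
  have len: "\<bar>\<sigma> v - \<sigma> (v @ [b])\<bar> =
      (if \<sigma> v < a b then a b - \<sigma> v else \<sigma> v - (a b + s - 1)) + entry_offset h \<sigma> (v @ [b])" for b
    using child_position[OF rec c 2, of b] 4(1)[of b] entry_offset_nonneg[of h \<sigma> "v @ [b]"]
    by auto
  note bounds = 3(1) 3(2)[of False] 3(2)[of True] 3(3)[of False] 3(3)[of True]
    4(1)[of False] 4(1)[of True] 4(2-4)
  show ?thesis
  proof (cases "in_order_type h \<sigma> v")
    case True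
    then have g: "child_gaps h \<sigma> v = 2"
      by (simp add: child_gaps_def)
    have "\<sigma> v = l + s"
      using in_order_position(1)[OF rec True 1] by (simp add: s_def)
    \<comment> \<open>With \<open>v\<close> at the midpoint the blocks fill the two sides
      completely, so both gaps are \<open>1\<close>.\<close>
    then show ?thesis
      unfolding len g using bounds by (auto split: if_splits)
  next
    case False
    then have g: "child_gaps h \<sigma> v = s + 2"
      by (simp add: child_gaps_def s_def)
    have "has_children h v" "v \<in> nodes h"
      using hv by (auto simp: has_children_iff nodes_def)
    then have "pre_order_type h \<sigma> v"
      using False rec unfolding recursive_layout_def by blast
    moreover have "Min {l..l + 2 * s} = l" "Max {l..l + 2 * s} = l + 2 * s"
      using 3(1) by (auto intro!: Min_eqI Max_eqI)
    ultimately have "\<sigma> v = l \<or> \<sigma> v = l + 2 * s"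
      by (simp add: pre_order_type_def 1)
    \<comment> \<open>With \<open>v\<close> at an end, the remaining \<open>2 * s\<close> positions
      are filled by the two blocks in a row, so the gaps are \<open>1\<close> and
      \<open>s + 1\<close>, whichever child comes first.\<close>
    then show ?thesis
      unfolding len g using bounds by (auto split: if_splits)
  qed
qed

section \<open>Regrouping the edge sum by nodes\<close>

lemma edges_eq_image:
  "edges h = (\<lambda>(v, b). (v, v @ [b])) ` (nodes (h - 1) \<times> UNIV)"
  by (auto simp: edges_def nodes_def image_def)

lemma sum_edges:
  fixes f :: "node \<times> node \<Rightarrow> real"
  shows "sum f (edges h) = (\<Sum>v\<in>nodes (h - 1). f (v, v @ [False]) + f (v, v @ [True]))"
proof -
  have "sum f (edges h) = (\<Sum>(v, b)\<in>nodes (h - 1) \<times> UNIV. f (v, v @ [b]))"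
    unfolding edges_eq_image by (subst sum.reindex) (auto simp: inj_on_def intro!: sum.cong)
  also have "\<dots> = (\<Sum>v\<in>nodes (h - 1). \<Sum>b\<in>UNIV. f (v, v @ [b]))"
    by (simp add: sum.cartesian_product)
  finally show ?thesis
    by (simp add: UNIV_bool add.commute)
qed

text \<open>Every non-root node is the lower end of exactly one edge, so \<open>snd\<close> maps
  \<open>edges h\<close> bijectively onto the non-root nodes.\<close>

lemma sum_children:
  fixes g :: "node \<Rightarrow> real"
  shows "(\<Sum>v\<in>nodes (h - 1). g (v @ [False]) + g (v @ [True])) = sum g (nodes h - {[]})"
proof -
  have "snd ` edges h = nodes h - {[]}"
  proof (intro equalityI subsetI)
    fix c assume "c \<in> nodes h - {[]}"
    then obtain v b where c: "c = v @ [b]" "v @ [b] \<in> nodes h"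
      by (cases c rule: rev_cases) auto
    then have "(v, c) \<in> edges h"
      by (auto simp: edges_def)
    then show "c \<in> snd ` edges h" by force
  qed (auto simp: edges_def)
  moreover have "inj_on snd (edges h)"
    by (auto simp: inj_on_def edges_def)
  ultimately have "sum g (nodes h - {[]}) = sum (g \<circ> snd) (edges h)"
    by (metis sum.reindex)
  then show ?thesis by (simp add: sum_edges)
qed

text \<open>The gaps at \<open>v\<close> belong to the edges below it, of weight half of
  \<open>1 / 2 ^ length v\<close>; the offset belongs to the edge above it, of weight
  \<open>1 / 2 ^ length v\<close>. The root has no edge above, hence the case distinction.\<close>

definition node_cost :: "nat \<Rightarrow> (node \<Rightarrow> int) \<Rightarrow> node \<Rightarrow> real" where
  "node_cost h \<sigma> v = (real_of_int (child_gaps h \<sigma> v) / 2 +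
     (if v = [] then 0 else real_of_int (entry_offset h \<sigma> v))) / 2 ^ length v"

text \<open>Each offset is moved from the parent, where \<open>child_edge_lengths\<close> produces
  it, to the child whose type determines it.\<close>

lemma total_edge_length:
  assumes rec: "recursive_layout h \<sigma>"
  shows "(\<Sum>e\<in>edges h. edge_weight e * edge_length \<sigma> e) = (\<Sum>v\<in>nodes (h - 1). node_cost h \<sigma> v)"
proof -
  define off :: "node \<Rightarrow> real" where "off v = entry_offset h \<sigma> v / 2 ^ length v" for v
  define gap :: "node \<Rightarrow> real" where "gap v = child_gaps h \<sigma> v / 2 / 2 ^ length v" for v
  have "(\<Sum>e\<in>edges h. edge_weight e * edge_length \<sigma> e) =
      (\<Sum>v\<in>nodes (h - 1). gap v + (off (v @ [False]) + off (v @ [True])))"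
    unfolding sum_edges
  proof (rule sum.cong[OF refl])
    fix v assume "v \<in> nodes (h - 1)"
    then have "Suc (length v) < h"
      by (simp add: nodes_def)
    from arg_cong[OF child_edge_lengths[OF rec this], of real_of_int]
    have *: "edge_length \<sigma> (v, v @ [False]) + edge_length \<sigma> (v, v @ [True]) =
        child_gaps h \<sigma> v + entry_offset h \<sigma> (v @ [False]) + entry_offset h \<sigma> (v @ [True])"
      unfolding edge_length_def by simp
    have "edge_weight (v, v @ [False]) * edge_length \<sigma> (v, v @ [False]) +
        edge_weight (v, v @ [True]) * edge_length \<sigma> (v, v @ [True]) =
        (edge_length \<sigma> (v, v @ [False]) + edge_length \<sigma> (v, v @ [True])) / (2 * 2 ^ length v)"
      by (simp add: edge_weight_def add_divide_distrib)
    also have "\<dots> = gap v + (off (v @ [False]) + off (v @ [True]))"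
      unfolding * gap_def off_def by (simp add: add_divide_distrib)
    finally show "edge_weight (v, v @ [False]) * edge_length \<sigma> (v, v @ [False]) +
        edge_weight (v, v @ [True]) * edge_length \<sigma> (v, v @ [True]) =
        gap v + (off (v @ [False]) + off (v @ [True]))" .
  qed
  also have "\<dots> = sum gap (nodes (h - 1)) + sum off (nodes h - {[]})"
    by (simp only: sum.distrib[of gap] sum_children)
  also have "sum off (nodes h - {[]}) = (\<Sum>v\<in>nodes (h - 1). if v = [] then 0 else off v)"
  proof -
    have "sum off (nodes h - {[]}) = (\<Sum>v\<in>nodes h. if v = [] then 0 else off v)"
      by (intro sum.mono_neutral_cong_left) (auto simp: finite_nodes)
    \<comment> \<open>The bottom level drops out because leaves have offset
      \<open>0\<close>.\<close>
    also have "\<dots> = (\<Sum>v\<in>nodes (h - 1). if v = [] then 0 else off v)"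
      by (intro sum.mono_neutral_right finite_nodes)
        (auto simp: nodes_def off_def entry_offset_def in_order_type_def has_children_iff)
    finally show ?thesis .
  qed
  also have "sum gap (nodes (h - 1)) + \<dots> = (\<Sum>v\<in>nodes (h - 1). node_cost h \<sigma> v)"
    unfolding sum.distrib[symmetric]
    by (intro sum.cong) (auto simp: node_cost_def gap_def off_def add_divide_distrib)
  finally show ?thesis .
qed

section \<open>Optimality, node by node\<close>

text \<open>With \<open>P = 2 ^ (h - length v - 1)\<close>, up to the factor
  \<open>1 / 2 ^ length v\<close>, in-order against pre-order costs \<open>1\<close> against
  \<open>(P + 1) / 2\<close> at the root and \<open>1 + (P - 1) = P\<close> against
  \<open>(P + 1) / 2\<close> elsewhere. As \<open>P \<ge> 1\<close>, in-order is the cheaper choice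
  at the root and pre-order below it.\<close>

lemma minwla_node_cost_le:
  assumes "minwla_layout h \<pi>" and v: "v \<in> nodes (h - 1)"
  shows "node_cost h \<pi> v \<le> node_cost h \<sigma> v"
proof -
  have pow: "(1::real) \<le> 2 ^ (h - length v - 1)"
    by simp
  have "has_children h v" "v \<in> nodes h"
    using v by (auto simp: has_children_iff nodes_def)
  then have "in_order_type h \<pi> v \<longleftrightarrow> v = []"
    using assms(1) in_order_not_pre_order by (auto simp: minwla_layout_def)
  then show ?thesis
    using pow unfolding node_cost_def child_gaps_def entry_offset_def
    by (intro divide_right_mono) auto
qed

theorem theorem1:
  fixes h :: nat and \<pi> :: "node \<Rightarrow> int"
  assumes "h \<ge> 2"
    and "minwla_layout h \<pi>"
  shows "recursive_layout h \<pi> \<and>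
    (\<forall>\<sigma>. recursive_layout h \<sigma> \<longrightarrow>
       weighted_mean_edge_length h \<pi> \<le> weighted_mean_edge_length h \<sigma>)"
proof (intro conjI allI impI)
  show rec: "recursive_layout h \<pi>"
    using assms(2) by (simp add: minwla_layout_def)
  fix \<sigma> assume "recursive_layout h \<sigma>"
  then have "(\<Sum>e\<in>edges h. edge_weight e * edge_length \<pi> e) \<le>
      (\<Sum>e\<in>edges h. edge_weight e * edge_length \<sigma> e)"
    using assms rec by (simp add: total_edge_length sum_mono minwla_node_cost_le)
  then show "weighted_mean_edge_length h \<pi> \<le> weighted_mean_edge_length h \<sigma>"
    \<comment> \<open>The denominator is the same nonnegative total weight for both layouts.\<close>
    unfolding weighted_mean_edge_length_def
    by (intro divide_right_mono sum_nonneg) (auto simp: edge_weight_def)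
qed

end
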